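(* Let $A=a_1a_2\ldots a_m$ and $B=b_1b_2\ldots b_n$ be sequences over an alphabet $\Sigma$, and for $0\le i\le m$, $0\le j\le n$ let $A_i=a_1\ldots a_i$ and $B_j=b_1\ldots b_j$ denote prefixes. Define the rank $L[i,j]$ as the length of a longest common subsequence of $A_i$ and $B_j$; equivalently $L[i,j]=0$ if $i=0$ or $j=0$, $L[i,j]=L[i-1,j-1]+1$ if $i,j>0$ and $a_i=b_j$, and $L[i,j]=\max\{L[i-1,j],L[i,j-1]\}$ otherwise. A pair $[i,j]$ with $1\le i\le m$, $1\le j\le n$ and $a_i=b_j$ is called a match. The all-prefixes-LCSs-graph is the directed graph whose vertices are all pairs $[i,j]$ with $0\le i\le m$, $0\le j\le n$, and in which there is an edge from $[i,j]$ to a match $[i^*,j^*]$ if and only if $L[i^*,j^*]=L[i,j]$, $i^*\le i$, $j^*\le j$, and there is no other match $[i',j']$ with $L[i',j']=L[i,j]$ such that either ($i'=i^*$ and $j\ge j'>j^*$) or ($j'=j^*$ and $i\ge i'>i^*$). For a fixed vertex $[i,j]$, define a backtrace from $[i,j]$ as follows: starting at the current vertex $v=[i,j]$, while $L[v]\ge 1$, choose an edge from $v$ to some match $[i^*,j^*]$, record the character $a_{i^*}$, and set the current vertex to $[i^*-1,j^*-1]$; stop when the current vertex has rank $0$. The string associated with a backtrace is the sequence of recorded characters in reverse order of recording. Then the map sending each backtrace from $[i,j]$ to its associated string is a bijection from the set of all backtraces from $[i,j]$ onto the set of distinct longest common subsequences (as character strings) of $A_i$ and $B_j$.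
   Context: A subsequence of a sequence is any sequence obtained by deleting some of its symbols; a common subsequence of two sequences is a subsequence of both; a longest common subsequence (LCS) is a common subsequence of maximum length. Two LCSs are considered the same if they are equal as character strings (regardless of where they occur in the input sequences). *)

theory Defs
  imports "HOL-Library.Sublist" "Graph_Theory.Pair_Digraph"
begin

definition common_subseqs :: "'a list \<Rightarrow> 'a list \<Rightarrow> 'a list set" where
  "common_subseqs xs ys = {s. subseq s xs \<and> subseq s ys}"

definition LCSs :: "'a list \<Rightarrow> 'a list \<Rightarrow> 'a list set" where
  "LCSs xs ys = {s \<in> common_subseqs xs ys. \<forall>t \<in> common_subseqs xs ys. length t \<le> length s}"

definition lcs_rank :: "'a list \<Rightarrow> 'a list \<Rightarrow> nat \<Rightarrow> nat \<Rightarrow> nat" where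
  "lcs_rank A B i j = Max (length ` common_subseqs (take i A) (take j B))"

text \<open>Positions are counted from 1, so the \<open>i\<close>-th symbol of \<open>A\<close> is \<open>A ! (i - 1)\<close>.\<close>

definition is_match :: "'a list \<Rightarrow> 'a list \<Rightarrow> nat \<Rightarrow> nat \<Rightarrow> bool" where
  "is_match A B i j \<longleftrightarrow>
     1 \<le> i \<and> i \<le> length A \<and> 1 \<le> j \<and> j \<le> length B \<and> A ! (i - 1) = B ! (j - 1)"

definition apl_edge :: "'a list \<Rightarrow> 'a list \<Rightarrow> nat \<times> nat \<Rightarrow> nat \<times> nat \<Rightarrow> bool" where
  "apl_edge A B = (\<lambda>(i, j) (i\<^sub>s, j\<^sub>s).
     is_match A B i\<^sub>s j\<^sub>s \<and>
     lcs_rank A B i\<^sub>s j\<^sub>s = lcs_rank A B i j \<and> i\<^sub>s \<le> i \<and> j\<^sub>s \<le> j \<and>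
     \<not> (\<exists>i' j'. (i', j') \<noteq> (i\<^sub>s, j\<^sub>s) \<and> is_match A B i' j' \<and>
           lcs_rank A B i' j' = lcs_rank A B i j \<and>
           ((i' = i\<^sub>s \<and> j \<ge> j' \<and> j' > j\<^sub>s) \<or> (j' = j\<^sub>s \<and> i \<ge> i' \<and> i' > i\<^sub>s))))"

definition all_prefixes_LCSs_graph :: "'a list \<Rightarrow> 'a list \<Rightarrow> (nat \<times> nat) pair_pre_digraph" where
  "all_prefixes_LCSs_graph A B =
     (let V = {0..length A} \<times> {0..length B}
      in \<lparr> pverts = V, parcs = {(v, w). v \<in> V \<and> w \<in> V \<and> apl_edge A B v w} \<rparr>)"

text \<open>A backtrace is represented by the list of its chosen edges, in the order of choice.\<close>

inductive backtrace ::
    "'a list \<Rightarrow> 'a list \<Rightarrow> nat \<times> nat \<Rightarrow> ((nat \<times> nat) \<times> (nat \<times> nat)) list \<Rightarrow> bool"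
  for A B :: "'a list" where
  stop: "(i, j) \<in> pverts (all_prefixes_LCSs_graph A B) \<Longrightarrow> lcs_rank A B i j = 0
         \<Longrightarrow> backtrace A B (i, j) []"
| step: "lcs_rank A B i j \<ge> 1 \<Longrightarrow> ((i, j), (i\<^sub>s, j\<^sub>s)) \<in> parcs (all_prefixes_LCSs_graph A B)
         \<Longrightarrow> backtrace A B (i\<^sub>s - 1, j\<^sub>s - 1) es
         \<Longrightarrow> backtrace A B (i, j) (((i, j), (i\<^sub>s, j\<^sub>s)) # es)"

definition backtrace_string :: "'a list \<Rightarrow> ((nat \<times> nat) \<times> (nat \<times> nat)) list \<Rightarrow> 'a list" where
  "backtrace_string A es = rev (map (\<lambda>(v, (i\<^sub>s, j\<^sub>s)). A ! (i\<^sub>s - 1)) es)"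

lemma finite_common_subseqs: "finite (common_subseqs xs ys)"
proof -
  have "common_subseqs xs ys \<subseteq> set (subseqs xs)"
    by (auto simp: common_subseqs_def)
  then show ?thesis
    using finite_subset by blast
qed

lemma Nil_in_common_subseqs: "[] \<in> common_subseqs xs ys"
  by (simp add: common_subseqs_def)

lemma lcs_rank_ge:
  assumes "s \<in> common_subseqs (take i A) (take j B)"
  shows "length s \<le> lcs_rank A B i j"
  unfolding lcs_rank_def using assms by (intro Max_ge) (auto simp: finite_common_subseqs)

lemma lcs_rank_attained:
  obtains s where "s \<in> common_subseqs (take i A) (take j B)" "length s = lcs_rank A B i j"
proof -
  have "lcs_rank A B i j \<in> length ` common_subseqs (take i A) (take j B)"
    unfolding lcs_rank_def using Nil_in_common_subseqs
    by (intro Max_in) (auto simp: finite_common_subseqs)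
  then show ?thesis using that by auto
qed

lemma length_LCS:
  assumes "s \<in> LCSs (take i A) (take j B)"
  shows "length s = lcs_rank A B i j"
proof -
  obtain t where t: "t \<in> common_subseqs (take i A) (take j B)" "length t = lcs_rank A B i j"
    by (rule lcs_rank_attained)
  then have "lcs_rank A B i j \<le> length s"
    using assms unfolding LCSs_def by auto
  moreover have "length s \<le> lcs_rank A B i j"
    using assms by (intro lcs_rank_ge) (simp add: LCSs_def)
  ultimately show ?thesis by simp
qed

lemma subseq_snoc_iff:
  "subseq s (xs @ [x]) \<longleftrightarrow> subseq s xs \<or> (\<exists>s'. s = s' @ [x] \<and> subseq s' xs)"
proof
  assume "subseq s (xs @ [x])"
  then obtain s1 s2 where s: "s = s1 @ s2" "subseq s1 xs" "subseq s2 [x]"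
    by (rule subseq_appendE)
  from s(3) have "s2 = [] \<or> s2 = [x]"
    by (cases s2) (auto split: if_splits)
  with s show "subseq s xs \<or> (\<exists>s'. s = s' @ [x] \<and> subseq s' xs)" by auto
qed (auto intro: subseq_rev_drop_many)

lemma lcs_rank_0:
  assumes "i = 0 \<or> j = 0"
  shows "lcs_rank A B i j = 0"
proof -
  have "common_subseqs (take i A) (take j B) = {[]}"
    using assms by (auto simp: common_subseqs_def)
  then show ?thesis by (simp add: lcs_rank_def)
qed

lemma take_pos: "0 < i \<Longrightarrow> i \<le> length A \<Longrightarrow> take i A = take (i - 1) A @ [A ! (i - 1)]"
  by (cases i) (auto simp: take_Suc_conv_app_nth)

lemma lcs_rank_match:
  assumes "is_match A B i j"
  shows "lcs_rank A B i j = lcs_rank A B (i - 1) (j - 1) + 1"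
proof (rule antisym)
  let ?c = "A ! (i - 1)"
  have A: "take i A = take (i - 1) A @ [?c]" and B: "take j B = take (j - 1) B @ [?c]"
    using assms take_pos[of i A] take_pos[of j B] by (auto simp: is_match_def)
  show "lcs_rank A B i j \<le> lcs_rank A B (i - 1) (j - 1) + 1"
  proof -
    obtain s where s: "s \<in> common_subseqs (take i A) (take j B)" "length s = lcs_rank A B i j"
      by (rule lcs_rank_attained)
    have "subseq (butlast s) (take (i - 1) A)" "subseq (butlast s) (take (j - 1) B)"
    proof -
      have "subseq (butlast s) zs" if "subseq s (zs @ [?c])" for zs
      proof -
        have "subseq (butlast s) s"
          by (intro prefix_imp_subseq) (simp add: prefixeq_butlast)
        with that show ?thesis
          unfolding subseq_snoc_iff by (auto intro: subseq_order.order_trans)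
      qed
      then show "subseq (butlast s) (take (i - 1) A)" "subseq (butlast s) (take (j - 1) B)"
        using s(1) unfolding common_subseqs_def A B by auto
    qed
    then have "length (butlast s) \<le> lcs_rank A B (i - 1) (j - 1)"
      by (intro lcs_rank_ge) (simp add: common_subseqs_def)
    with s(2) show ?thesis by simp
  qed
  obtain s where s: "s \<in> common_subseqs (take (i - 1) A) (take (j - 1) B)"
      "length s = lcs_rank A B (i - 1) (j - 1)"
    by (rule lcs_rank_attained)
  have "s @ [?c] \<in> common_subseqs (take i A) (take j B)"
    using s(1) unfolding A B common_subseqs_def by simp
  then have "length (s @ [?c]) \<le> lcs_rank A B i j"
    by (rule lcs_rank_ge)
  with s(2) show "lcs_rank A B (i - 1) (j - 1) + 1 \<le> lcs_rank A B i j" by simp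
qed

lemma lcs_rank_mono:
  assumes "i \<le> i'" "j \<le> j'"
  shows "lcs_rank A B i j \<le> lcs_rank A B i' j'"
proof -
  obtain s where s: "s \<in> common_subseqs (take i A) (take j B)" "length s = lcs_rank A B i j"
    by (rule lcs_rank_attained)
  have "subseq (take i A) (take i' A)" "subseq (take j B) (take j' B)"
    using assms
    by (metis min.absorb1 prefix_imp_subseq take_is_prefix take_take)+
  then have "s \<in> common_subseqs (take i' A) (take j' B)"
    using s(1) unfolding common_subseqs_def by (auto intro: subseq_order.order_trans)
  then show ?thesis using s(2) lcs_rank_ge by metis
qed

lemma lcs_rank_nomatch:
  assumes "0 < i" "i \<le> length A" "0 < j" "j \<le> length B" "\<not> is_match A B i j"
  shows "lcs_rank A B i j = max (lcs_rank A B (i - 1) j) (lcs_rank A B i (j - 1))"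
proof (rule antisym)
  have ne: "A ! (i - 1) \<noteq> B ! (j - 1)"
    using assms by (auto simp: is_match_def)
  obtain s where s: "s \<in> common_subseqs (take i A) (take j B)" "length s = lcs_rank A B i j"
    by (rule lcs_rank_attained)
  have "subseq s (take (i - 1) A) \<or> subseq s (take (j - 1) B)"
    using s(1) ne take_pos[OF assms(1,2)] take_pos[OF assms(3,4)]
    by (auto simp: common_subseqs_def subseq_snoc_iff)
  then have "s \<in> common_subseqs (take (i - 1) A) (take j B) \<or>
      s \<in> common_subseqs (take i A) (take (j - 1) B)"
    using s(1) by (auto simp: common_subseqs_def)
  then show "lcs_rank A B i j \<le> max (lcs_rank A B (i - 1) j) (lcs_rank A B i (j - 1))"
    using lcs_rank_ge s(2) by (metis max.coboundedI1 max.coboundedI2)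
qed (simp add: lcs_rank_mono)

end

theory Submission
  imports Defs
begin

text \<open>
  The edges leaving a vertex \<open>[i,j]\<close> correspond to the possible last letters of a longest common
  subsequence of \<open>A\<^sub>i\<close> and \<open>B\<^sub>j\<close>: the edge for the letter \<open>c\<close> leads to the pair formed by the last
  occurrence of \<open>c\<close> in \<open>A\<^sub>i\<close> and the last occurrence of \<open>c\<close> in \<open>B\<^sub>j\<close>. Indeed, if \<open>c\<close> occurred again
  behind the target of an edge, in \<open>A\<^sub>i\<close> say, then replacing the row by that occurrence would give
  another match in the same column, whose rank is squeezed by monotonicity to that of \<open>[i,j]\<close>.
  So the recorded letter determines the edge, and every longest common subsequence
  can be read off backwards in exactly one way.
\<close>

text \<open>Turns maximality into a length equation, so that membership in \<open>LCSs\<close> can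
  be carried between prefixes by rank arithmetic.\<close>

lemma LCSs_take_iff:
  "s \<in> LCSs (take i A) (take j B) \<longleftrightarrow>
     s \<in> common_subseqs (take i A) (take j B) \<and> length s = lcs_rank A B i j"
proof
  assume "s \<in> LCSs (take i A) (take j B)"
  then show "s \<in> common_subseqs (take i A) (take j B) \<and> length s = lcs_rank A B i j"
    using length_LCS[of s i A j B] by (auto simp: LCSs_def)
qed (auto simp: LCSs_def intro: lcs_rank_ge)

lemma subseq_take_mono: "i \<le> i' \<Longrightarrow> subseq s (take i xs) \<Longrightarrow> subseq s (take i' xs)"
  by (metis min.absorb1 prefix_imp_subseq subseq_order.order_trans take_is_prefix take_take)

text \<open>Matching \<open>c\<close> as late as possible leaves the longest prefix for
  \<open>s\<close>. The induction drops trailing letters other than \<open>c\<close> until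
  \<open>c\<close> stands last.\<close>

lemma subseq_snoc_last_occurrence:
  assumes "subseq (s @ [c]) (take i xs)" "i \<le> length xs"
  obtains p where "1 \<le> p" "p \<le> i" "xs ! (p - 1) = c" "subseq s (take (p - 1) xs)"
    "\<forall>k\<in>{p<..i}. xs ! (k - 1) \<noteq> c"
  using assms
proof (induction i arbitrary: thesis)
  case 0
  then show ?case by simp
next
  case (Suc i)
  have t: "take (Suc i) xs = take i xs @ [xs ! i]"
    using Suc.prems(3) by (simp add: take_Suc_conv_app_nth)
  show ?case
  proof (cases "xs ! i = c")
    case True
    have "subseq s (take i xs)"
      using Suc.prems(2) True by (simp add: t)
    with True show ?thesis
      by (intro Suc.prems(1)[of "Suc i"]) auto
  next
    case False
    then have "subseq (s @ [c]) (take i xs)"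
      using Suc.prems(2) by (auto simp: t subseq_snoc_iff)
    then obtain p where p: "1 \<le> p" "p \<le> i" "xs ! (p - 1) = c" "subseq s (take (p - 1) xs)"
      "\<forall>k\<in>{p<..i}. xs ! (k - 1) \<noteq> c"
      using Suc.IH Suc.prems(3) by auto
    show ?thesis
    proof (rule Suc.prems(1)[of p])
      show "\<forall>k\<in>{p<..Suc i}. xs ! (k - 1) \<noteq> c"
        using p(5) False by (auto simp: le_Suc_eq)
    qed (use p in auto)
  qed
qed

lemma parcs_all_prefixes_LCSs_graph_iff:
  "((i, j), (p, q)) \<in> parcs (all_prefixes_LCSs_graph A B) \<longleftrightarrow>
     i \<le> length A \<and> j \<le> length B \<and> apl_edge A B (i, j) (p, q)"
  by (auto simp: all_prefixes_LCSs_graph_def Let_def apl_edge_def is_match_def)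

lemma pverts_all_prefixes_LCSs_graph_iff:
  "(i, j) \<in> pverts (all_prefixes_LCSs_graph A B) \<longleftrightarrow> i \<le> length A \<and> j \<le> length B"
  by (auto simp: all_prefixes_LCSs_graph_def Let_def)

lemma apl_edge_last_occurrence:
  assumes "apl_edge A B (i, j) (p, q)" "i \<le> length A" "j \<le> length B"
  shows "p < k \<Longrightarrow> k \<le> i \<Longrightarrow> A ! (k - 1) \<noteq> A ! (p - 1)"
    and "q < l \<Longrightarrow> l \<le> j \<Longrightarrow> B ! (l - 1) \<noteq> A ! (p - 1)"
proof -
  have m: "is_match A B p q" and r: "lcs_rank A B p q = lcs_rank A B i j" and le: "p \<le> i" "q \<le> j"
    and no: "\<And>p' q'. is_match A B p' q' \<Longrightarrow> lcs_rank A B p' q' = lcs_rank A B i j \<Longrightarrow>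
      \<not> (p' = p \<and> q' \<le> j \<and> q < q') \<and> \<not> (q' = q \<and> p' \<le> i \<and> p < p')"
    using assms(1) by (auto simp: apl_edge_def)
  \<comment> \<open>Monotonicity makes the rank constant on the whole rectangle between
    \<open>[p,q]\<close> and \<open>[i,j]\<close>, so the competitors \<open>[k,q]\<close> and
    \<open>[p,l]\<close> below have the rank that \<open>no\<close> asks for.\<close>
  have sq: "lcs_rank A B p' q' = lcs_rank A B i j"
    if "p \<le> p'" "p' \<le> i" "q \<le> q'" "q' \<le> j" for p' q'
    using that r by (metis antisym lcs_rank_mono)
  show "A ! (k - 1) \<noteq> A ! (p - 1)" if "p < k" "k \<le> i"
    using no[of k q] sq[of k q] that m le assms by (auto simp: is_match_def)
  show "B ! (l - 1) \<noteq> A ! (p - 1)" if "q < l" "l \<le> j"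
    using no[of p l] sq[of p l] that m le assms by (auto simp: is_match_def)
qed

lemma apl_edge_unique:
  assumes "apl_edge A B (i, j) (p, q)" "apl_edge A B (i, j) (p', q')"
    and "i \<le> length A" "j \<le> length B" "A ! (p - 1) = A ! (p' - 1)"
  shows "(p, q) = (p', q')"
proof -
  have le: "p \<le> i" "q \<le> j" "p' \<le> i" "q' \<le> j"
    and B: "B ! (q - 1) = A ! (p - 1)" "B ! (q' - 1) = A ! (p' - 1)"
    using assms(1,2) by (auto simp: apl_edge_def is_match_def)
  \<comment> \<open>Were they different, the larger position would carry the common letter behind
    the smaller one, which is its last occurrence.\<close>
  have "p = p'"
    using apl_edge_last_occurrence(1)[OF assms(1,3,4), of p']
      apl_edge_last_occurrence(1)[OF assms(2,3,4), of p] le assms(5)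
    by (metis linorder_neqE_nat)
  moreover have "q = q'"
    using apl_edge_last_occurrence(2)[OF assms(1,3,4), of q']
      apl_edge_last_occurrence(2)[OF assms(2,3,4), of q] le assms(5) B
    by (metis linorder_neqE_nat)
  ultimately show ?thesis by simp
qed

text \<open>The lengths fit because a match has rank one more than \<open>[p-1,q-1]\<close>, while
  an edge preserves the rank of \<open>[i,j]\<close>.\<close>

lemma LCSs_snoc_apl_edge:
  assumes "apl_edge A B (i, j) (p, q)" "s \<in> LCSs (take (p - 1) A) (take (q - 1) B)"
  shows "s @ [A ! (p - 1)] \<in> LCSs (take i A) (take j B)"
proof -
  have m: "is_match A B p q" and r: "lcs_rank A B p q = lcs_rank A B i j" and le: "p \<le> i" "q \<le> j"
    using assms(1) by (auto simp: apl_edge_def)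
  have "subseq (s @ [A ! (p - 1)]) (take p A)" "subseq (s @ [A ! (p - 1)]) (take q B)"
    using m assms(2) take_pos[of p A] take_pos[of q B]
    by (auto simp: LCSs_take_iff common_subseqs_def is_match_def)
  then show ?thesis
    using assms(2) lcs_rank_match[OF m] r le
    by (auto simp: LCSs_take_iff common_subseqs_def intro: subseq_take_mono)
qed

lemma LCSs_snoc_obtain_apl_edge:
  assumes "s @ [c] \<in> LCSs (take i A) (take j B)" "i \<le> length A" "j \<le> length B"
  obtains p q where "apl_edge A B (i, j) (p, q)" "A ! (p - 1) = c"
    "s \<in> LCSs (take (p - 1) A) (take (q - 1) B)"
proof -
  have sub: "subseq (s @ [c]) (take i A)" "subseq (s @ [c]) (take j B)"
    and len: "Suc (length s) = lcs_rank A B i j"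
    using assms(1) by (auto simp: LCSs_take_iff common_subseqs_def)
  obtain p where p: "1 \<le> p" "p \<le> i" "A ! (p - 1) = c" "subseq s (take (p - 1) A)"
      "\<forall>k\<in>{p<..i}. A ! (k - 1) \<noteq> c"
    using sub(1) assms(2) by (rule subseq_snoc_last_occurrence)
  obtain q where q: "1 \<le> q" "q \<le> j" "B ! (q - 1) = c" "subseq s (take (q - 1) B)"
      "\<forall>k\<in>{q<..j}. B ! (k - 1) \<noteq> c"
    using sub(2) assms(3) by (rule subseq_snoc_last_occurrence)
  have m: "is_match A B p q"
    using p q assms by (auto simp: is_match_def)
  have cs: "s \<in> common_subseqs (take (p - 1) A) (take (q - 1) B)"
    using p q by (simp add: common_subseqs_def)
  \<comment> \<open>A squeeze: \<open>s\<close> forces rank at least \<open>length s\<close> at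
    \<open>[p-1,q-1]\<close> and the match adds one, so the rank at \<open>[p,q]\<close> already
    reaches that of \<open>[i,j]\<close>.\<close>
  have "lcs_rank A B p q \<le> lcs_rank A B i j"
    using p(2) q(2) by (rule lcs_rank_mono)
  with lcs_rank_ge[OF cs] lcs_rank_match[OF m] len
  have r: "lcs_rank A B p q = lcs_rank A B i j" "length s = lcs_rank A B (p - 1) (q - 1)"
    by linarith+
  show ?thesis
  proof (rule that)
    \<comment> \<open>A competing match in row \<open>p\<close> or column \<open>q\<close> would put
      \<open>c\<close> behind \<open>q\<close> or \<open>p\<close>, contrary to their choice as last
      occurrences.\<close>
    show "apl_edge A B (i, j) (p, q)"
      using m r p q unfolding apl_edge_def is_match_def by auto
    show "s \<in> LCSs (take (p - 1) A) (take (q - 1) B)"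
      using cs r by (simp add: LCSs_take_iff)
  qed (rule p(3))
qed

lemma backtrace_string_Nil [simp]: "backtrace_string A [] = []"
  by (simp add: backtrace_string_def)

lemma backtrace_string_Cons [simp]:
  "backtrace_string A ((v, (p, q)) # es) = backtrace_string A es @ [A ! (p - 1)]"
  by (simp add: backtrace_string_def)

lemma backtrace_string_in_LCSs:
  "backtrace A B (i, j) es \<Longrightarrow> backtrace_string A es \<in> LCSs (take i A) (take j B)"
proof (induction "(i, j)" es arbitrary: i j rule: backtrace.induct)
  case stop
  then show ?case by (simp add: LCSs_take_iff Nil_in_common_subseqs)
next
  case step
  then show ?case
    using LCSs_snoc_apl_edge by (fastforce simp: parcs_all_prefixes_LCSs_graph_iff)
qed

text \<open>The rank of the current vertex decides whether to stop, so both backtraces stop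
  together. Otherwise their first edges record the same letter, hence coincide, and the remainders
  start at the same vertex.\<close>

lemma backtrace_string_inj:
  "backtrace A B (i, j) es \<Longrightarrow> backtrace A B (i, j) es' \<Longrightarrow>
     backtrace_string A es = backtrace_string A es' \<Longrightarrow> es = es'"
proof (induction "(i, j)" es arbitrary: i j es' rule: backtrace.induct)
  case (stop i j)
  from stop.prems(1) show ?case
    by (cases rule: backtrace.cases) (use stop in auto)
next
  case (step i j p q es)
  from step.prems(1) show ?case
  proof (cases rule: backtrace.cases)
    case stop
    then show ?thesis using step by simp
  next
    case (step p' q' fs)
    have eq: "A ! (p - 1) = A ! (p' - 1)" "backtrace_string A es = backtrace_string A fs"
      using \<open>backtrace_string A _ = _\<close> step(1) by auto
    have "(p, q) = (p', q')"
      using \<open>((i, j), (p, q)) \<in> _\<close> step(3) eq(1)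
      by (auto simp: parcs_all_prefixes_LCSs_graph_iff dest: apl_edge_unique)
    then show ?thesis
      using step eq(2) step.hyps(4) by auto
  qed
qed

text \<open>Reverse induction on \<open>s\<close> removes letters in the order in which a backtrace
  records them.\<close>

lemma LCSs_obtain_backtrace:
  assumes "s \<in> LCSs (take i A) (take j B)" "i \<le> length A" "j \<le> length B"
  shows "\<exists>es. backtrace A B (i, j) es \<and> backtrace_string A es = s"
  using assms
proof (induction s arbitrary: i j rule: rev_induct)
  case Nil
  then have "lcs_rank A B i j = 0"
    by (simp add: LCSs_take_iff)
  with Nil.prems show ?case
    by (intro exI[of _ "[]"]) (simp add: backtrace.stop pverts_all_prefixes_LCSs_graph_iff)
next
  case (snoc c s)
  obtain p q where e: "apl_edge A B (i, j) (p, q)" "A ! (p - 1) = c"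
      "s \<in> LCSs (take (p - 1) A) (take (q - 1) B)"
    using snoc.prems by (rule LCSs_snoc_obtain_apl_edge)
  have le: "p \<le> i" "q \<le> j"
    using e(1) by (auto simp: apl_edge_def)
  obtain es where es: "backtrace A B (p - 1, q - 1) es" "backtrace_string A es = s"
    using snoc.IH[OF e(3)] le snoc.prems by (meson diff_le_self order_trans)
  have "lcs_rank A B i j \<ge> 1"
    using snoc.prems(1) by (simp add: LCSs_take_iff)
  then have "backtrace A B (i, j) (((i, j), (p, q)) # es)"
    using e(1) es(1) snoc.prems
    by (intro backtrace.step) (auto simp: parcs_all_prefixes_LCSs_graph_iff)
  then show ?case using es(2) e(2)
    by (intro exI[of _ "((i, j), (p, q)) # es"]) simp
qed

theorem theorem1:
  fixes A B :: "'a list" and i j :: nat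
  assumes "(i, j) \<in> pverts (all_prefixes_LCSs_graph A B)"
  shows "bij_betw (backtrace_string A)
           {es. backtrace A B (i, j) es} (LCSs (take i A) (take j B))"
  unfolding bij_betw_def
proof (intro conjI inj_onI set_eqI iffI)
  show "s \<in> backtrace_string A ` {es. backtrace A B (i, j) es}"
    if "s \<in> LCSs (take i A) (take j B)" for s
    using LCSs_obtain_backtrace[OF that] assms
    by (auto simp: pverts_all_prefixes_LCSs_graph_iff)
qed (auto intro: backtrace_string_in_LCSs backtrace_string_inj)

end
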